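(* The expected competitive ratio of the randomized online algorithm $\mathrm{gCHASE}_s^r$ for problem SP is $2$. Here $\mathrm{gCHASE}_s^r$ sets $s_0\leftarrow 0$ and, for $t=1,\dots,T$, upon receiving $\sigma_t$ computes $\Delta(t)$ and: if $\Delta(t)=0$ sets $s_t\leftarrow1$; else if $\Delta(t)=-\beta$ sets $s_t\leftarrow0$; otherwise, if $\Delta(t-1)\le\Delta(t)$: when $s_{t-1}=1$ it sets $s_t\leftarrow1$, and when $s_{t-1}=0$ it sets $s_t\leftarrow0$ with probability $\Delta(t)/\Delta(t-1)$ and $s_t\leftarrow1$ with probability $1-\Delta(t)/\Delta(t-1)$; and if $\Delta(t-1)>\Delta(t)$: when $s_{t-1}=0$ it sets $s_t\leftarrow0$, and when $s_{t-1}=1$ it sets $s_t\leftarrow0$ with probability $1-\frac{\beta+\Delta(t)}{\beta+\Delta(t-1)}$ and $s_t\leftarrow1$ with probability $\frac{\beta+\Delta(t)}{\beta+\Delta(t-1)}$.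
   Context: Fix a horizon $T\in\mathbb{N}$, a constant cancellation fee $\beta>0$ and a constant $H$. At each time $t\in\{1,\dots,T\}$ an input $\sigma_t=(e_t,p^0_t,p^1_t,B_t)$ determines a cost function $g_t:\{0,1\}\to\mathbb{R}$ by $g_t(1)=e_t p^1_t$ and $g_t(0)=e_t p^0_t+(p^1_t-p^0_t)(e_t-1.1B_t)^+-H(0.9B_t-e_t)^+$, where $(x)^+=\max\{x,0\}$; these cost functions are taken to be nonnegative. Problem SP: given $\boldsymbol{\sigma}=(\sigma_1,\dots,\sigma_T)$, minimize $\mathrm{Cost}(\boldsymbol{s})=\sum_{t=1}^T\big(g_t(s_t)+\beta(s_t-s_{t-1})^+\big)$ over $(s_1,\dots,s_T)\in\{0,1\}^T$, with initial state $s_0=0$; $\mathrm{Opt}(s_0,\boldsymbol{\sigma})$ is the optimal value. Define $\delta(t)=g_t(0)-g_t(1)$, $\Delta(0)=-\beta$, $\Delta(t)=\min\{0,\max\{\Delta(t-1)+\delta(t),-\beta\}\}$ for $t\ge1$. A randomized online algorithm $\mathcal{A}$ chooses each $s_t$ (possibly at random) based only on $\sigma_1,\dots,\sigma_t$ and its past random choices; its expected competitive ratio is the smallest $c$ such that there is a constant $\gamma(s_0)$ depending only on $s_0$ with $\mathbb{E}[\mathrm{Cost}_{\mathcal{A}}(s_0,\boldsymbol{\sigma})]\le c\cdot\mathrm{Opt}(s_0,\boldsymbol{\sigma})+\gamma(s_0)$ for all input sequences $\boldsymbol{\sigma}$, the expectation being over the algorithm's random choices. *)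

theory Defs
  imports "HOL-Probability.Probability"
begin

text \<open>States: \<open>False\<close> stands for 0 and \<open>True\<close> for 1; numerical values are taken with \<open>of_bool\<close>.\<close>

datatype sp_input = SP_Input (in_e: real) (in_p0: real) (in_p1: real) (in_B: real)

definition pos_part :: "real \<Rightarrow> real" where
  "pos_part x = max x 0"

definition g :: "real \<Rightarrow> sp_input \<Rightarrow> bool \<Rightarrow> real" where
  "g H i s =
     (if s then in_e i * in_p1 i
      else in_e i * in_p0 i + (in_p1 i - in_p0 i) * pos_part (in_e i - 1.1 * in_B i)
             - H * pos_part (0.9 * in_B i - in_e i))"

text \<open>An input sequence is the list of \<open>\<sigma>\<^sub>1, \<dots>, \<sigma>\<^sub>T\<close>, so its length is the horizon \<open>T\<close> and
  \<open>\<sigma>\<^sub>t\<close> is \<open>\<sigma> ! (t - 1)\<close>. The only restriction on inputs is that the cost functions are nonnegative.\<close>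

definition valid_inputs :: "real \<Rightarrow> sp_input list \<Rightarrow> bool" where
  "valid_inputs H \<sigma> \<longleftrightarrow> (\<forall>i \<in> set \<sigma>. \<forall>s. g H i s \<ge> 0)"

text \<open>Trajectories include the initial state: they are lists \<open>[s\<^sub>0, s\<^sub>1, \<dots>, s\<^sub>T]\<close>.\<close>

definition Cost :: "real \<Rightarrow> real \<Rightarrow> sp_input list \<Rightarrow> bool list \<Rightarrow> real" where
  "Cost \<beta> H \<sigma> ss =
     (\<Sum>t = 1..length \<sigma>. g H (\<sigma> ! (t - 1)) (ss ! t)
        + \<beta> * pos_part (of_bool (ss ! t) - of_bool (ss ! (t - 1))))"

definition Opt :: "real \<Rightarrow> real \<Rightarrow> bool \<Rightarrow> sp_input list \<Rightarrow> real" where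
  "Opt \<beta> H s0 \<sigma> = Min {Cost \<beta> H \<sigma> (s0 # ss) | ss. length ss = length \<sigma>}"

definition \<delta> :: "real \<Rightarrow> sp_input list \<Rightarrow> nat \<Rightarrow> real" where
  "\<delta> H \<sigma> t = g H (\<sigma> ! (t - 1)) False - g H (\<sigma> ! (t - 1)) True"

primrec \<Delta> :: "real \<Rightarrow> real \<Rightarrow> sp_input list \<Rightarrow> nat \<Rightarrow> real" where
  "\<Delta> \<beta> H \<sigma> 0 = - \<beta>"
| "\<Delta> \<beta> H \<sigma> (Suc t) = min 0 (max (\<Delta> \<beta> H \<sigma> t + \<delta> H \<sigma> (Suc t)) (- \<beta>))"

text \<open>A randomized online algorithm maps the inputs \<open>[\<sigma>\<^sub>1, \<dots>, \<sigma>\<^sub>t]\<close> revealed so far and the states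
  \<open>[s\<^sub>0, \<dots>, s\<^sub>t\<^sub>-\<^sub>1]\<close> chosen so far to the conditional distribution of \<open>s\<^sub>t\<close>.\<close>

type_synonym online_alg = "sp_input list \<Rightarrow> bool list \<Rightarrow> bool pmf"

text \<open>Distribution of the trajectory \<open>[s\<^sub>0, \<dots>, s\<^sub>t]\<close>.\<close>

primrec run :: "online_alg \<Rightarrow> bool \<Rightarrow> sp_input list \<Rightarrow> nat \<Rightarrow> bool list pmf" where
  "run A s0 \<sigma> 0 = return_pmf [s0]"
| "run A s0 \<sigma> (Suc t) =
     bind_pmf (run A s0 \<sigma> t) (\<lambda>ss. map_pmf (\<lambda>s. ss @ [s]) (A (take (Suc t) \<sigma>) ss))"

definition expected_cost :: "real \<Rightarrow> real \<Rightarrow> online_alg \<Rightarrow> bool \<Rightarrow> sp_input list \<Rightarrow> real" where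
  "expected_cost \<beta> H A s0 \<sigma> =
     measure_pmf.expectation (run A s0 \<sigma> (length \<sigma>)) (Cost \<beta> H \<sigma>)"

text \<open>The additive constant may depend on the initial state (and on the fixed constants \<open>\<beta>\<close>, \<open>H\<close>) but
  not on the inputs; in particular it is uniform in the horizon \<open>length \<sigma>\<close>.\<close>

definition competitive :: "real \<Rightarrow> real \<Rightarrow> online_alg \<Rightarrow> bool \<Rightarrow> real \<Rightarrow> bool" where
  "competitive \<beta> H A s0 c \<longleftrightarrow>
     (\<exists>\<gamma>. \<forall>\<sigma>. valid_inputs H \<sigma> \<longrightarrow> expected_cost \<beta> H A s0 \<sigma> \<le> c * Opt \<beta> H s0 \<sigma> + \<gamma>)"

definition is_expected_competitive_ratio ::
    "real \<Rightarrow> real \<Rightarrow> online_alg \<Rightarrow> bool \<Rightarrow> real \<Rightarrow> bool" where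
  "is_expected_competitive_ratio \<beta> H A s0 c \<longleftrightarrow>
     competitive \<beta> H A s0 c \<and> (\<forall>c'. competitive \<beta> H A s0 c' \<longrightarrow> c \<le> c')"

text \<open>\<open>bernoulli_pmf p\<close> gives state 1 probability \<open>p\<close>. For \<open>\<beta> > 0\<close> the parameters below are in
  \<open>[0, 1]\<close> and the denominators are nonzero.\<close>

definition gCHASE :: "real \<Rightarrow> real \<Rightarrow> online_alg" where
  "gCHASE \<beta> H \<sigma> ss =
     (let t = length \<sigma>; D = \<Delta> \<beta> H \<sigma> t; D' = \<Delta> \<beta> H \<sigma> (t - 1); s' = last ss in
      if D = 0 then return_pmf True
      else if D = - \<beta> then return_pmf False
      else if D' \<le> D then
        (if s' then return_pmf True else bernoulli_pmf (1 - D / D'))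
      else
        (if s' then bernoulli_pmf ((\<beta> + D) / (\<beta> + D')) else return_pmf False))"

end

theory Submission
  imports Defs
begin

text \<open>
  The step probabilities of \<open>gCHASE\<close> are chosen so that state 1 has marginal probability
  \<open>x\<^sub>t = 1 + \<Delta>(t)/\<beta>\<close> and the expected switching cost of step \<open>t\<close> is \<open>(\<Delta>(t) - \<Delta>(t-1))\<^sup>+\<close>.
  On the offline side, \<open>\<Delta>(t)\<close> is the difference of the normalised work functions of states 0 and 1.
  With the potential \<open>(\<beta> + \<Delta>(t))\<^sup>2 / (2\<beta>)\<close>, the expected cost of a step plus the change of
  potential is at most twice the increase of the work function of state 0, which gives the upper
  bound 2 with additive constant 0.

  For the lower bound, inputs with cost pairs \<open>(g\<^sub>t(0), g\<^sub>t(1))\<close> alternating between \<open>(\<epsilon>, 0)\<close> and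
  \<open>(0, \<epsilon>)\<close> cost the algorithm \<open>2\<epsilon> - \<epsilon>\<^sup>2/\<beta>\<close> per period, whereas staying in state 0 costs \<open>\<epsilon>\<close>.
\<close>

subsection \<open>Dynamics of the algorithm\<close>

lemma expectation_bind_pmf_finite:
  fixes h :: "'b \<Rightarrow> real"
  assumes "finite (set_pmf p)" "\<And>x. finite (set_pmf (f x))"
  shows "measure_pmf.expectation (bind_pmf p f) h
       = measure_pmf.expectation p (\<lambda>x. measure_pmf.expectation (f x) h)"
proof -
  have "measure_pmf.expectation (bind_pmf p f) h
      = (\<Sum>x\<in>set_pmf p. pmf p x *\<^sub>R measure_pmf.expectation (f x) h)"
    by (rule pmf_expectation_bind) (use assms in auto)
  also have "\<dots> = measure_pmf.expectation p (\<lambda>x. measure_pmf.expectation (f x) h)"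
    by (rule integral_measure_pmf[symmetric]) (use assms(1) in auto)
  finally show ?thesis .
qed

lemma \<Delta>_bounds:
  assumes "\<beta> > 0"
  shows "- \<beta> \<le> \<Delta> \<beta> H \<sigma> t \<and> \<Delta> \<beta> H \<sigma> t \<le> 0"
  using assms by (induction t) auto

lemma \<Delta>_take: "t \<le> n \<Longrightarrow> \<Delta> \<beta> H (take n \<sigma>) t = \<Delta> \<beta> H \<sigma> t"
  by (induction t) (auto simp: \<delta>_def)

text \<open>Conditional probability of moving to state 1 from state \<open>s\<close>, as a plain
  real number, so that the random and the deterministic branches of \<open>gCHASE\<close> share one
  formula.\<close>

definition prob_on :: "real \<Rightarrow> real \<Rightarrow> real \<Rightarrow> bool \<Rightarrow> real" where
  "prob_on \<beta> D' D s =
     (if D = 0 then 1 else if D = - \<beta> then 0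
      else if D' \<le> D then (if s then 1 else 1 - D / D')
      else (if s then (\<beta> + D) / (\<beta> + D') else 0))"

text \<open>These are the joint probabilities of the transitions 1 to 1 and 0 to 1 when the previous
  state is 1 with probability \<open>1 + D' / \<beta>\<close>. Multiplying by the marginal cancels
  the denominators in \<open>prob_on\<close>; only the excess mass changes state.\<close>

lemma prob_on_marginals:
  assumes "\<beta> > 0" "- \<beta> \<le> D'" "D' \<le> 0" "- \<beta> \<le> D" "D \<le> 0"
  shows "(1 + D' / \<beta>) * prob_on \<beta> D' D True = 1 + min D D' / \<beta>"
    and "(- D' / \<beta>) * prob_on \<beta> D' D False = max (D - D') 0 / \<beta>"
  using assms by (auto simp: prob_on_def min_def max_def divide_simps)

lemma expectation_gCHASE:
  fixes f :: "bool \<Rightarrow> real" and \<beta> H :: real and ss :: "bool list"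
  assumes "\<beta> > 0" "Suc t \<le> length \<sigma>"
  defines "q \<equiv> prob_on \<beta> (\<Delta> \<beta> H \<sigma> t) (\<Delta> \<beta> H \<sigma> (Suc t)) (last ss)"
  shows "measure_pmf.expectation (gCHASE \<beta> H (take (Suc t) \<sigma>) ss) f = f True * q + f False * (1 - q)"
proof -
  define D' D where "D' = \<Delta> \<beta> H \<sigma> t" and "D = \<Delta> \<beta> H \<sigma> (Suc t)"
  have b: "- \<beta> \<le> D'" "D' \<le> 0" "- \<beta> \<le> D" "D \<le> 0"
    unfolding D'_def D_def using \<Delta>_bounds[OF assms(1)] by blast+
  have len: "length (take (Suc t) \<sigma>) = Suc t"
    using assms(2) by simp
  have take: "\<Delta> \<beta> H (take (Suc t) \<sigma>) t = D'" "\<Delta> \<beta> H (take (Suc t) \<sigma>) (Suc t) = D"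
    unfolding D'_def D_def by (rule \<Delta>_take; simp)+
  have eq: "gCHASE \<beta> H (take (Suc t) \<sigma>) ss =
     (if D = 0 then return_pmf True
      else if D = - \<beta> then return_pmf False
      else if D' \<le> D then
        (if last ss then return_pmf True else bernoulli_pmf (1 - D / D'))
      else
        (if last ss then bernoulli_pmf ((\<beta> + D) / (\<beta> + D')) else return_pmf False))"
    unfolding gCHASE_def Let_def len diff_Suc_1 take ..
  \<comment> \<open>The parameter of \<open>bernoulli_pmf\<close> is the success probability only if
    it lies in the unit interval.\<close>
  have "0 \<le> 1 - D / D' \<and> 1 - D / D' \<le> 1" if "D \<noteq> 0" "D' \<le> D"
    using that b by (auto simp: divide_simps)
  moreover have "0 \<le> (\<beta> + D) / (\<beta> + D') \<and> (\<beta> + D) / (\<beta> + D') \<le> 1" if "\<not> D' \<le> D"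
    using that b by (auto simp: divide_simps)
  ultimately show ?thesis
    unfolding eq q_def D'_def[symmetric] D_def[symmetric] prob_on_def by auto
qed

lemma finite_set_bool_pmf: "finite (set_pmf (p :: bool pmf))"
  by (rule finite_subset[of _ UNIV]) auto

lemma finite_set_run: "finite (set_pmf (run A s0 \<sigma> t))"
  by (induction t) (auto intro: finite_set_bool_pmf)

lemma length_run: "ss \<in> set_pmf (run A s0 \<sigma> t) \<Longrightarrow> length ss = Suc t"
  by (induction t arbitrary: ss) auto

lemma expectation_run_Suc:
  fixes f :: "bool list \<Rightarrow> real"
  shows "measure_pmf.expectation (run A s0 \<sigma> (Suc t)) f
       = measure_pmf.expectation (run A s0 \<sigma> t)
           (\<lambda>ss. measure_pmf.expectation (A (take (Suc t) \<sigma>) ss) (\<lambda>s. f (ss @ [s])))"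
  by (simp add: expectation_bind_pmf_finite finite_set_run finite_set_bool_pmf)

text \<open>The function \<open>f\<close> is arbitrary because the induction hypothesis is applied
  to the conditional expectation \<open>?k\<close> of the next step.\<close>

lemma expectation_last_state:
  fixes f :: "bool \<Rightarrow> real" and \<beta> H :: real
  assumes "\<beta> > 0" "t \<le> length \<sigma>"
  defines "D \<equiv> \<Delta> \<beta> H \<sigma> t"
  shows "measure_pmf.expectation (run (gCHASE \<beta> H) False \<sigma> t) (\<lambda>ss. f (last ss))
       = f True * (1 + D / \<beta>) + f False * (- D / \<beta>)"
  using assms(2) unfolding D_def
proof (induction t arbitrary: f)
  case 0
  then show ?case using assms(1) by simp
next
  case (Suc t)
  define D' D where "D' = \<Delta> \<beta> H \<sigma> t" and "D = \<Delta> \<beta> H \<sigma> (Suc t)"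
  have b: "- \<beta> \<le> D'" "D' \<le> 0" "- \<beta> \<le> D" "D \<le> 0"
    unfolding D'_def D_def using \<Delta>_bounds[OF assms(1)] by blast+
  let ?q = "prob_on \<beta> D' D"
  let ?k = "\<lambda>s. f True * ?q s + f False * (1 - ?q s)"
  have "measure_pmf.expectation (run (gCHASE \<beta> H) False \<sigma> (Suc t)) (\<lambda>ss. f (last ss))
      = measure_pmf.expectation (run (gCHASE \<beta> H) False \<sigma> t) (\<lambda>ss. ?k (last ss))"
    unfolding expectation_run_Suc last_snoc
    using expectation_gCHASE[OF assms(1) Suc.prems] unfolding D'_def D_def by simp
  also have "\<dots> = ?k True * (1 + D' / \<beta>) + ?k False * (- D' / \<beta>)"
    using Suc.IH[of ?k] Suc.prems unfolding D'_def by simp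
  also have "\<dots> = (f True - f False) * ((1 + D' / \<beta>) * ?q True + (- D' / \<beta>) * ?q False) + f False"
    by (simp add: algebra_simps add_divide_distrib diff_divide_distrib)
  also have "(1 + D' / \<beta>) * ?q True + (- D' / \<beta>) * ?q False = 1 + D / \<beta>"
    unfolding prob_on_marginals[OF assms(1) b] by (auto simp: min_def max_def diff_divide_distrib)
  finally show ?case
    unfolding D_def by (simp add: algebra_simps add_divide_distrib diff_divide_distrib del: \<Delta>.simps)
qed

subsection \<open>Expected cost\<close>

text \<open>Separating the number of steps from the length of the input allows induction over time
  with \<open>\<sigma>\<close> fixed.\<close>

definition cost_upto :: "real \<Rightarrow> real \<Rightarrow> sp_input list \<Rightarrow> nat \<Rightarrow> bool list \<Rightarrow> real" where
  "cost_upto \<beta> H \<sigma> n ss =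
     (\<Sum>t = 1..n. g H (\<sigma> ! (t - 1)) (ss ! t)
        + \<beta> * pos_part (of_bool (ss ! t) - of_bool (ss ! (t - 1))))"

lemma Cost_eq_cost_upto: "Cost \<beta> H \<sigma> = cost_upto \<beta> H \<sigma> (length \<sigma>)"
  by (rule ext) (simp add: Cost_def cost_upto_def)

lemma cost_upto_Suc:
  "cost_upto \<beta> H \<sigma> (Suc n) ss = cost_upto \<beta> H \<sigma> n ss
     + (g H (\<sigma> ! n) (ss ! Suc n) + \<beta> * pos_part (of_bool (ss ! Suc n) - of_bool (ss ! n)))"
  by (simp add: cost_upto_def)

lemma cost_upto_append: "n < length ss \<Longrightarrow> cost_upto \<beta> H \<sigma> n (ss @ ss') = cost_upto \<beta> H \<sigma> n ss"
  unfolding cost_upto_def by (intro sum.cong) (auto simp: nth_append)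

text \<open>Expected cost at time \<open>n + 1\<close>, whose input is \<open>\<sigma> ! n\<close>.
  The last summand is \<open>\<beta>\<close> times the probability of a switch from 0 to 1.\<close>

definition step_cost :: "real \<Rightarrow> real \<Rightarrow> sp_input list \<Rightarrow> nat \<Rightarrow> real" where
  "step_cost \<beta> H \<sigma> n =
     (let D = \<Delta> \<beta> H \<sigma> (Suc n) in
      g H (\<sigma> ! n) True * (1 + D / \<beta>) + g H (\<sigma> ! n) False * (- D / \<beta>)
        + pos_part (D - \<Delta> \<beta> H \<sigma> n))"

lemma expectation_cost_upto:
  assumes "\<beta> > 0" "n \<le> length \<sigma>"
  shows "measure_pmf.expectation (run (gCHASE \<beta> H) False \<sigma> n) (cost_upto \<beta> H \<sigma> n)
       = (\<Sum>k<n. step_cost \<beta> H \<sigma> k)"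
  using assms(2)
proof (induction n)
  case 0
  then show ?case by (simp add: cost_upto_def)
next
  case (Suc n)
  let ?R = "run (gCHASE \<beta> H) False \<sigma>"
  define D' D where "D' = \<Delta> \<beta> H \<sigma> n" and "D = \<Delta> \<beta> H \<sigma> (Suc n)"
  have b: "- \<beta> \<le> D'" "D' \<le> 0" "- \<beta> \<le> D" "D \<le> 0"
    unfolding D'_def D_def using \<Delta>_bounds[OF assms(1)] by blast+
  let ?q = "prob_on \<beta> D' D"
  let ?u = "g H (\<sigma> ! n) False" and ?v = "g H (\<sigma> ! n) True"
  let ?k = "\<lambda>s. (?v + \<beta> * of_bool (\<not> s)) * ?q s + ?u * (1 - ?q s)"
  have step: "measure_pmf.expectation (gCHASE \<beta> H (take (Suc n) \<sigma>) ss)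
          (\<lambda>s. cost_upto \<beta> H \<sigma> (Suc n) (ss @ [s])) = cost_upto \<beta> H \<sigma> n ss + ?k (last ss)"
    if "ss \<in> set_pmf (?R n)" for ss
  proof -
    have len: "length ss = Suc n" using length_run[OF that] .
    hence l: "last ss = ss ! n" by (subst last_conv_nth) auto
    show ?thesis
      unfolding expectation_gCHASE[OF assms(1) Suc.prems] D'_def[symmetric] D_def[symmetric]
      using len by (auto simp: cost_upto_Suc cost_upto_append nth_append l pos_part_def algebra_simps)
  qed
  \<comment> \<open>The identity \<open>step\<close> uses the length of the trajectory, which is
    known only on the support, hence a congruence almost everywhere.\<close>
  have "measure_pmf.expectation (?R (Suc n)) (cost_upto \<beta> H \<sigma> (Suc n))
      = measure_pmf.expectation (?R n) (\<lambda>ss. cost_upto \<beta> H \<sigma> n ss + ?k (last ss))"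
    unfolding expectation_run_Suc
    by (rule integral_cong_AE) (auto simp: AE_measure_pmf_iff step)
  also have "\<dots> = measure_pmf.expectation (?R n) (cost_upto \<beta> H \<sigma> n)
      + measure_pmf.expectation (?R n) (\<lambda>ss. ?k (last ss))"
    by (rule Bochner_Integration.integral_add) (intro integrable_measure_pmf_finite finite_set_run)+
  also have "measure_pmf.expectation (?R n) (\<lambda>ss. ?k (last ss))
      = ?k True * (1 + D' / \<beta>) + ?k False * (- D' / \<beta>)"
    using Suc.prems expectation_last_state[OF assms(1), where t = n and \<sigma> = \<sigma> and f = ?k and H = H]
    unfolding D'_def by simp
  \<comment> \<open>Regrouping by the joint transition probabilities isolates the switching cost in
    the last term.\<close>
  also have "\<dots> = (?v - ?u) * ((1 + D' / \<beta>) * ?q True + (- D' / \<beta>) * ?q False) + ?u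
      + \<beta> * ((- D' / \<beta>) * ?q False)"
    by (simp add: algebra_simps add_divide_distrib diff_divide_distrib)
  also have "\<dots> = step_cost \<beta> H \<sigma> n"
    unfolding prob_on_marginals[OF assms(1) b] step_cost_def Let_def D'_def[symmetric] D_def[symmetric]
    using assms(1) by (auto simp: pos_part_def min_def max_def field_simps)
  finally show ?case using Suc by simp
qed

lemma expected_cost_gCHASE:
  "\<beta> > 0 \<Longrightarrow> expected_cost \<beta> H (gCHASE \<beta> H) False \<sigma> = (\<Sum>k<length \<sigma>. step_cost \<beta> H \<sigma> k)"
  unfolding expected_cost_def Cost_eq_cost_upto by (rule expectation_cost_upto) auto

subsection \<open>Upper bound\<close>

text \<open>The work function of state 0, normalised by allowing a free switch from state 1 to
  state 0 at the end; the work function of state 1 is \<open>work t - \<Delta> t\<close>.\<close>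

primrec work :: "real \<Rightarrow> real \<Rightarrow> sp_input list \<Rightarrow> nat \<Rightarrow> real" where
  "work \<beta> H \<sigma> 0 = 0"
| "work \<beta> H \<sigma> (Suc n) =
     work \<beta> H \<sigma> n + min (g H (\<sigma> ! n) False) (g H (\<sigma> ! n) True - \<Delta> \<beta> H \<sigma> n)"

text \<open>Dynamic programming over the last transition. The bounds on \<open>\<Delta>\<close>
  handle the switches: \<open>\<Delta> \<le> 0\<close> makes arriving in 0 from 1 no cheaper than
  staying in 0, and \<open>- \<beta> \<le> \<Delta>\<close> makes paying the fee no cheaper than
  staying in 1.\<close>

lemma work_le_cost_upto:
  assumes "\<beta> > 0" "ss ! 0 = False"
  shows "work \<beta> H \<sigma> n - (if ss ! n then \<Delta> \<beta> H \<sigma> n else 0) \<le> cost_upto \<beta> H \<sigma> n ss"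
proof (induction n)
  case 0
  then show ?case using assms by (simp add: cost_upto_def)
next
  case (Suc n)
  then show ?case
    using \<Delta>_bounds[OF assms(1), of H \<sigma> n] assms(1)
    by (auto simp: cost_upto_Suc \<delta>_def pos_part_def min_def max_def split: if_splits)
qed

lemma finite_costs: "finite {Cost \<beta> H \<sigma> (s0 # ss) | ss. length ss = length \<sigma>}"
proof -
  have "finite {ss :: bool list. length ss = length \<sigma>}"
    using finite_lists_length_eq[of "UNIV :: bool set" "length \<sigma>"] by simp
  hence "finite ((\<lambda>ss. Cost \<beta> H \<sigma> (s0 # ss)) ` {ss. length ss = length \<sigma>})" by simp
  thus ?thesis by (simp add: image_Collect)
qed

lemma Opt_le: "length ss = length \<sigma> \<Longrightarrow> Opt \<beta> H s0 \<sigma> \<le> Cost \<beta> H \<sigma> (s0 # ss)"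
  unfolding Opt_def by (rule Min_le[OF finite_costs]) auto

lemma work_le_Opt:
  assumes "\<beta> > 0"
  shows "work \<beta> H \<sigma> (length \<sigma>) \<le> Opt \<beta> H False \<sigma>"
proof -
  have "work \<beta> H \<sigma> (length \<sigma>) \<le> Cost \<beta> H \<sigma> (False # ss)" for ss
    using work_le_cost_upto[OF assms, of "False # ss" H \<sigma> "length \<sigma>"]
      \<Delta>_bounds[OF assms, of H \<sigma> "length \<sigma>"]
    by (auto simp: Cost_eq_cost_upto split: if_splits)
  moreover have "{Cost \<beta> H \<sigma> (False # ss) | ss. length ss = length \<sigma>} \<noteq> {}"
    by (auto intro: Ex_list_of_length)
  ultimately show ?thesis
    unfolding Opt_def by (intro Min.boundedI[OF finite_costs]) auto
qed

text \<open>By \<open>sq\<close>, the potential change is its tangent term at the new value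
  \<open>D\<close> minus a square. Tangent term and service cost together equal
  \<open>min u (v - D')\<close> in each case, which uses one copy of the right-hand side; the other
  copy covers the switching cost.\<close>

lemma potential_step:
  fixes u v D :: real
  assumes "\<beta> > 0" "u \<ge> 0" "v \<ge> 0" "- \<beta> \<le> D'" "D' \<le> 0"
  defines "D \<equiv> min 0 (max (D' + (u - v)) (- \<beta>))"
  shows "v * (1 + D / \<beta>) + u * (- D / \<beta>) + pos_part (D - D')
           + ((\<beta> + D)\<^sup>2 - (\<beta> + D')\<^sup>2) / (2 * \<beta>)
         \<le> 2 * min u (v - D')"
proof -
  have sq: "((\<beta> + D)\<^sup>2 - (\<beta> + D')\<^sup>2) / (2 * \<beta>) = (D - D') * (1 + D / \<beta>) - (D - D')\<^sup>2 / (2 * \<beta>)"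
    using assms(1) by (simp add: field_simps power2_eq_square)
  have nn: "(D - D')\<^sup>2 / (2 * \<beta>) \<ge> 0" using assms(1) by simp
  consider "D' + (u - v) \<le> - \<beta>" | "D' + (u - v) \<ge> 0" | "D = D' + (u - v)" "- \<beta> \<le> D" "D \<le> 0"
    unfolding D_def by linarith
  then show ?thesis
  proof cases
    case 1
    hence D: "D = - \<beta>" using assms by (auto simp: D_def)
    have "v * (1 + D / \<beta>) + u * (- D / \<beta>) + (D - D') * (1 + D / \<beta>) = u"
      using D assms(1) by simp
    moreover have "pos_part (D - D') = 0"
      using D assms by (simp add: pos_part_def)
    moreover have "min u (v - D') = u" using 1 assms by simp
    ultimately show ?thesis unfolding sq using nn assms(2) by linarith
  next
    case 2
    hence D: "D = 0" using assms by (auto simp: D_def)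
    have "v * (1 + D / \<beta>) + u * (- D / \<beta>) + (D - D') * (1 + D / \<beta>) = v - D'"
      using D by simp
    moreover have "pos_part (D - D') = - D'"
      using D assms by (simp add: pos_part_def)
    moreover have m: "min u (v - D') = v - D'" using 2 by simp
    ultimately show ?thesis unfolding sq m using nn assms(3) by argo
  next
    case 3
    have "D - D' = u - v" using 3(1) by simp
    then have "v * (1 + D / \<beta>) + u * (- D / \<beta>) + (D - D') * (1 + D / \<beta>) = u"
      by (simp only:) (simp add: algebra_simps diff_divide_distrib)
    moreover have "pos_part (D - D') \<le> u"
      using 3(1) assms by (auto simp: pos_part_def)
    moreover have "min u (v - D') = u" using 3 by simp
    ultimately show ?thesis unfolding sq using nn by linarith
  qed
qed

text \<open>Telescoping sum of \<open>potential_step\<close>; the potential starts at 0 because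
  \<open>\<Delta>\<close> starts at \<open>- \<beta>\<close>.\<close>

lemma sum_step_cost_le:
  assumes "\<beta> > 0" "valid_inputs H \<sigma>" "n \<le> length \<sigma>"
  shows "(\<Sum>k<n. step_cost \<beta> H \<sigma> k) + (\<beta> + \<Delta> \<beta> H \<sigma> n)\<^sup>2 / (2 * \<beta>) \<le> 2 * work \<beta> H \<sigma> n"
  using assms(3)
proof (induction n)
  case 0
  then show ?case by simp
next
  case (Suc n)
  let ?D' = "\<Delta> \<beta> H \<sigma> n" and ?D = "\<Delta> \<beta> H \<sigma> (Suc n)"
  let ?u = "g H (\<sigma> ! n) False" and ?v = "g H (\<sigma> ! n) True"
  have "?u \<ge> 0" "?v \<ge> 0" "- \<beta> \<le> ?D'" "?D' \<le> 0"
    using assms(2) Suc.prems \<Delta>_bounds[OF assms(1)] by (auto simp: valid_inputs_def)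
  from potential_step[OF assms(1) this]
  have "step_cost \<beta> H \<sigma> n + ((\<beta> + ?D)\<^sup>2 / (2 * \<beta>) - (\<beta> + ?D')\<^sup>2 / (2 * \<beta>))
      \<le> 2 * min ?u (?v - ?D')"
    by (simp add: step_cost_def Let_def \<delta>_def diff_divide_distrib)
  with Suc show ?case by (simp del: \<Delta>.simps)
qed

lemma gCHASE_le_2_Opt:
  assumes "\<beta> > 0" "valid_inputs H \<sigma>"
  shows "expected_cost \<beta> H (gCHASE \<beta> H) False \<sigma> \<le> 2 * Opt \<beta> H False \<sigma>"
proof -
  have "(\<beta> + \<Delta> \<beta> H \<sigma> (length \<sigma>))\<^sup>2 / (2 * \<beta>) \<ge> 0" using assms(1) by simp
  with sum_step_cost_le[OF assms order_refl] work_le_Opt[OF assms(1), of H \<sigma>]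
  show ?thesis unfolding expected_cost_gCHASE[OF assms(1)] by linarith
qed

subsection \<open>Lower bound\<close>

text \<open>With \<open>e = B = 1\<close> both positive parts in \<open>g\<close> vanish, so \<open>p0\<close> and \<open>p1\<close> are the costs of the
  two states.\<close>

definition alternating :: "real \<Rightarrow> nat \<Rightarrow> sp_input list" where
  "alternating \<epsilon> N =
     map (\<lambda>k. if even k then SP_Input 1 \<epsilon> 0 1 else SP_Input 1 0 \<epsilon> 1) [0..<2 * N]"

lemma length_alternating [simp]: "length (alternating \<epsilon> N) = 2 * N"
  by (simp add: alternating_def)

lemma g_alternating:
  "k < 2 * N \<Longrightarrow> g H (alternating \<epsilon> N ! k) s = (if even k \<noteq> s then \<epsilon> else 0)"
  by (auto simp: alternating_def g_def pos_part_def)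

lemma valid_alternating: "\<epsilon> \<ge> 0 \<Longrightarrow> valid_inputs H (alternating \<epsilon> N)"
  unfolding valid_inputs_def by (auto simp: in_set_conv_nth g_alternating)

text \<open>The condition \<open>\<epsilon> < \<beta>\<close> keeps the upper truncation at 0 from
  being reached.\<close>

lemma \<Delta>_alternating:
  assumes "0 < \<epsilon>" "\<epsilon> < \<beta>" "k \<le> 2 * N"
  shows "\<Delta> \<beta> H (alternating \<epsilon> N) k = (if even k then - \<beta> else \<epsilon> - \<beta>)"
  using assms by (induction k) (auto simp: \<delta>_def g_alternating)

lemma sum_even_lessThan_double: "(\<Sum>k<2 * N. if even k then c else 0) = real N * c"
  by (induction N) (auto simp: algebra_simps)

text \<open>At even indices the service cost is
  \<open>\<epsilon> * (1 - \<epsilon> / \<beta>)\<close> and the switching cost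
  \<open>\<epsilon>\<close>; at odd ones the algorithm is surely back in state 0, at no
  cost.\<close>

lemma expected_cost_alternating:
  assumes "0 < \<epsilon>" "\<epsilon> < \<beta>"
  shows "expected_cost \<beta> H (gCHASE \<beta> H) False (alternating \<epsilon> N) = real N * (2 * \<epsilon> - \<epsilon>\<^sup>2 / \<beta>)"
proof -
  have "\<beta> > 0" using assms by simp
  have "step_cost \<beta> H (alternating \<epsilon> N) k = (if even k then 2 * \<epsilon> - \<epsilon>\<^sup>2 / \<beta> else 0)"
    if "k < 2 * N" for k
    using that assms unfolding step_cost_def Let_def
    by (simp add: \<Delta>_alternating g_alternating pos_part_def field_simps power2_eq_square
             del: \<Delta>.simps)
  then show ?thesis
    unfolding expected_cost_gCHASE[OF \<open>\<beta> > 0\<close>] by (simp add: sum_even_lessThan_double)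
qed

lemma Opt_alternating_le: "Opt \<beta> H False (alternating \<epsilon> N) \<le> real N * \<epsilon>"
proof -
  let ?ss = "replicate (2 * N) False"
  have "cost_upto \<beta> H (alternating \<epsilon> N) n (False # ?ss) = (\<Sum>k<n. if even k then \<epsilon> else 0)"
    if "n \<le> 2 * N" for n
    using that
  proof (induction n)
    case 0
    then show ?case by (simp add: cost_upto_def)
  next
    case (Suc n)
    moreover have "(False # ?ss) ! n = False"
      using Suc.prems by (cases n) auto
    ultimately show ?case by (simp add: cost_upto_Suc g_alternating pos_part_def)
  qed
  from this[of "2 * N"] show ?thesis
    using Opt_le[of ?ss "alternating \<epsilon> N" \<beta> H False]
    by (simp add: Cost_eq_cost_upto sum_even_lessThan_double)
qed

text \<open>Letting \<open>N\<close> grow removes the additive constant of the competitive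
  bound.\<close>

lemma le_of_linear_bound:
  fixes a b \<gamma> :: real
  assumes "\<And>N :: nat. real N * a \<le> real N * b + \<gamma>"
  shows "a \<le> b"
proof (rule ccontr)
  assume "\<not> a \<le> b"
  then obtain N :: nat where "real N * (a - b) > \<gamma>"
    using ex_less_of_nat_mult[of "a - b" \<gamma>] by auto
  with assms[of N] show False by (simp add: algebra_simps)
qed

lemma competitive_gCHASE_ge_2:
  assumes "\<beta> > 0" "competitive \<beta> H (gCHASE \<beta> H) False c"
  shows "2 \<le> c"
proof -
  obtain \<gamma> where \<gamma>: "\<And>\<sigma>. valid_inputs H \<sigma> \<Longrightarrow>
      expected_cost \<beta> H (gCHASE \<beta> H) False \<sigma> \<le> c * Opt \<beta> H False \<sigma> + \<gamma>"
    using assms(2) by (auto simp: competitive_def)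
  \<comment> \<open>Follows from the upper bound: twice the optimum dominates a nonnegative expected
    cost.\<close>
  have Opt_nonneg: "Opt \<beta> H False (alternating \<epsilon> N) \<ge> 0" if "0 < \<epsilon>" "\<epsilon> < \<beta>" for \<epsilon> N
  proof -
    have "\<epsilon>\<^sup>2 / \<beta> \<le> 2 * \<epsilon>" using that by (simp add: field_simps power2_eq_square)
    hence "real N * (2 * \<epsilon> - \<epsilon>\<^sup>2 / \<beta>) \<ge> 0" by simp
    with gCHASE_le_2_Opt[OF assms(1) valid_alternating, of \<epsilon> H N] show ?thesis
      unfolding expected_cost_alternating[OF that] using that by simp
  qed
  \<comment> \<open>The sign of \<open>c\<close> is still open; \<open>max c 0\<close> allows
    \<open>Opt\<close> to be replaced by its upper bound.\<close>
  have ratio: "2 - \<epsilon> / \<beta> \<le> max c 0" if "0 < \<epsilon>" "\<epsilon> < \<beta>" for \<epsilon>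
  proof -
    have "real N * (2 * \<epsilon> - \<epsilon>\<^sup>2 / \<beta>) \<le> real N * (max c 0 * \<epsilon>) + \<gamma>" for N
    proof -
      let ?O = "Opt \<beta> H False (alternating \<epsilon> N)"
      have "real N * (2 * \<epsilon> - \<epsilon>\<^sup>2 / \<beta>) \<le> c * ?O + \<gamma>"
        using \<gamma>[OF valid_alternating, of \<epsilon> N] that
        unfolding expected_cost_alternating[OF that] by simp
      also have "c * ?O \<le> max c 0 * ?O"
        by (rule mult_right_mono) (use Opt_nonneg[OF that] in auto)
      also have "\<dots> \<le> max c 0 * (real N * \<epsilon>)"
        by (rule mult_left_mono[OF Opt_alternating_le]) simp
      finally show ?thesis by (simp add: mult.left_commute)
    qed
    hence "2 * \<epsilon> - \<epsilon>\<^sup>2 / \<beta> \<le> max c 0 * \<epsilon>"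
      by (rule le_of_linear_bound)
    hence "(2 - \<epsilon> / \<beta>) * \<epsilon> \<le> max c 0 * \<epsilon>"
      by (simp add: algebra_simps power2_eq_square)
    thus ?thesis using that(1) by (rule mult_right_le_imp_le)
  qed
  have "2 \<le> max c 0"
  proof (rule field_le_epsilon)
    fix r :: real
    assume "0 < r"
    \<comment> \<open>The factor \<open>r\<close> bounds the loss
      \<open>\<epsilon> / \<beta>\<close>, and the cap \<open>1 / 2\<close> ensures
      \<open>\<epsilon> < \<beta>\<close>.\<close>
    define \<epsilon> where "\<epsilon> = \<beta> * min r (1 / 2)"
    have "0 < \<epsilon>" "\<epsilon> < \<beta>" "\<epsilon> / \<beta> \<le> r"
      using assms(1) \<open>0 < r\<close> by (auto simp: \<epsilon>_def min_def)
    with ratio[of \<epsilon>] show "2 \<le> max c 0 + r" by linarith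
  qed
  thus ?thesis by simp
qed

theorem theorem5:
  fixes \<beta> H :: real
  assumes "\<beta> > 0"
  shows "is_expected_competitive_ratio \<beta> H (gCHASE \<beta> H) False 2"
proof -
  have "competitive \<beta> H (gCHASE \<beta> H) False 2"
    unfolding competitive_def using gCHASE_le_2_Opt[OF assms] by (intro exI[of _ 0]) simp
  with competitive_gCHASE_ge_2[OF assms] show ?thesis
    unfolding is_expected_competitive_ratio_def by blast
qed

end
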